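(* Let $G=(\mathbb Z/4)*(\mathbb Z/4)$ and suppose that $g\in G^0$ is a stationary word. Let $s>0$ be irrational and let $z\in\mathbb C$ be arbitrary. Then $g_{s,z}$ has a positive density set of fixed points in $\mathbb C$. In particular, $g_{s,z}$ has infinitely many periodic islands of period $1$.
   Context: For $s>0$ and $z\in\mathbb C$, let $G_{s,z}$ be the infinite grid of squares of side length $s$ in $\mathbb C$, with sides parallel to the coordinate axes, having $z$ as a vertex. Let $R_{s,z}$ be the map, defined on the interiors of the squares of $G_{s,z}$, which rotates each square about its own center clockwise by $\pi/2$. Let $A_1,A_2$ be the standard generators of the free product $G=(\mathbb Z/4)*(\mathbb Z/4)$. Let $G^0\subset G$ be the index $4$ subgroup of words whose total exponent is divisible by $4$. Given $s>0$ and $z\in\mathbb C$, for $g\in G$ let $g_{s,z}$ be the partially defined map of $\mathbb C$ obtained from the word $g$ by replacing $A_1$ with $R_{1,0}$ and $A_2$ with $R_{s,z}$ and composing (it is defined at a point when every successive map in the composition is defined). When $g\in G^0$, $g_{s,z}$ is a piecewise translation. Let $H:G\to \mathrm{Isom}(\mathbb C)$ be the homomorphism for which $H(A_1)$ is the counterclockwise rotation by $\pi/2$ about $0$ and $H(A_2)$ is the counterclockwise rotation by $\pi/2$ about $1$. A word $g\in G^0$ is stationary if $H(g)$ is the identity; the stationary words form the kernel of $H$. For a piecewise translation $R$ of this kind and a periodic point $p$ of $R$, the periodic island of $p$ is the maximal open convex polygon containing $p$ on which $R$ is entirely defined and periodic; its period is the period of $p$. Density of a subset of $\mathbb C$ means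 asymptotic area density in the plane: $E\subset\mathbb C$ has positive density if $\liminf_{r\to\infty}\mathrm{area}(E\cap B_r(0))/(\pi r^2)>0$.
   Formalization: The claim of infinitely many periodic islands of period 1 is stated only for words in which some generator actually occurs: for the empty word g_{s,z} is the identity on all of the plane and has no maximal polygon; the density claim covers all stationary words. *)

theory Defs
  imports "HOL-Analysis.Analysis" "HOL-Algebra.Elementary_Groups"
begin

section \<open>Free products of two groups\<close>

text \<open>
  The library has no free products of groups, so we use the textbook construction: words over the
  disjoint union of the two carriers, modulo the least congruence that deletes letters which are
  the neutral element of a factor and multiplies adjacent letters of the same factor.
\<close>

abbreviation fp_words :: "('a, 'c) monoid_scheme \<Rightarrow> ('b, 'd) monoid_scheme \<Rightarrow> ('a + 'b) list set"
  where "fp_words A B \<equiv> lists (carrier A <+> carrier B)"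

inductive fp_eq ::
  "('a, 'c) monoid_scheme \<Rightarrow> ('b, 'd) monoid_scheme \<Rightarrow> ('a + 'b) list \<Rightarrow> ('a + 'b) list \<Rightarrow> bool"
  for A B where
  refl: "w \<in> fp_words A B \<Longrightarrow> fp_eq A B w w"
| sym: "fp_eq A B v w \<Longrightarrow> fp_eq A B w v"
| trans: "fp_eq A B u v \<Longrightarrow> fp_eq A B v w \<Longrightarrow> fp_eq A B u w"
| oneL: "u \<in> fp_words A B \<Longrightarrow> v \<in> fp_words A B \<Longrightarrow> fp_eq A B (u @ [Inl \<one>\<^bsub>A\<^esub>] @ v) (u @ v)"
| oneR: "u \<in> fp_words A B \<Longrightarrow> v \<in> fp_words A B \<Longrightarrow> fp_eq A B (u @ [Inr \<one>\<^bsub>B\<^esub>] @ v) (u @ v)"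
| multL: "u \<in> fp_words A B \<Longrightarrow> v \<in> fp_words A B \<Longrightarrow> x \<in> carrier A \<Longrightarrow> y \<in> carrier A
    \<Longrightarrow> fp_eq A B (u @ [Inl x, Inl y] @ v) (u @ [Inl (x \<otimes>\<^bsub>A\<^esub> y)] @ v)"
| multR: "u \<in> fp_words A B \<Longrightarrow> v \<in> fp_words A B \<Longrightarrow> x \<in> carrier B \<Longrightarrow> y \<in> carrier B
    \<Longrightarrow> fp_eq A B (u @ [Inr x, Inr y] @ v) (u @ [Inr (x \<otimes>\<^bsub>B\<^esub> y)] @ v)"

definition fp_rel ::
  "('a, 'c) monoid_scheme \<Rightarrow> ('b, 'd) monoid_scheme \<Rightarrow> (('a + 'b) list \<times> ('a + 'b) list) set"
  where "fp_rel A B = {(v, w). fp_eq A B v w}"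

definition free_product ::
  "('a, 'c) monoid_scheme \<Rightarrow> ('b, 'd) monoid_scheme \<Rightarrow> ('a + 'b) list set monoid"
  where "free_product A B =
    \<lparr>carrier = fp_words A B // fp_rel A B,
     monoid.mult = (\<lambda>X Y. \<Union>u\<in>X. \<Union>v\<in>Y. fp_rel A B `` {u @ v}),
     one = fp_rel A B `` {[]}\<rparr>"

lemma fp_eq_words:
  assumes "group A" "group B" "fp_eq A B v w"
  shows "v \<in> fp_words A B \<and> w \<in> fp_words A B"
proof -
  interpret A: group A by fact
  interpret B: group B by fact
  show ?thesis using assms(3) by induction auto
qed

lemma equiv_fp_rel:
  assumes "group A" "group B"
  shows "equiv (fp_words A B) (fp_rel A B)"
proof (rule equivI)
  show "fp_rel A B \<subseteq> fp_words A B \<times> fp_words A B"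
    using fp_eq_words[OF assms] by (auto simp: fp_rel_def simp del: in_lists_conv_set)
  show "refl_on (fp_words A B) (fp_rel A B)"
    by (rule refl_onI) (auto simp: fp_rel_def simp del: in_lists_conv_set intro: fp_eq.refl)
  show "sym (fp_rel A B)"
    by (rule symI) (simp add: fp_rel_def fp_eq.sym)
  show "trans (fp_rel A B)"
    by (rule transI, unfold fp_rel_def mem_Collect_eq case_prod_conv) (rule fp_eq.trans)
qed

lemma fp_eq_append_left:
  assumes "fp_eq A B v w" "a \<in> fp_words A B"
  shows "fp_eq A B (a @ v) (a @ w)"
  using assms(1)
proof induction
  case (refl w)
  then show ?case using assms(2) by (intro fp_eq.refl) auto
next
  case (oneL u v)
  then show ?case using fp_eq.oneL[of "a @ u" A B v] assms(2) by auto
next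
  case (oneR u v)
  then show ?case using fp_eq.oneR[of "a @ u" A B v] assms(2) by auto
next
  case (multL u v x y)
  then show ?case using fp_eq.multL[of "a @ u" A B v x y] assms(2) by auto
next
  case (multR u v x y)
  then show ?case using fp_eq.multR[of "a @ u" A B v x y] assms(2) by auto
qed (erule fp_eq.sym, erule (1) fp_eq.trans)

lemma fp_eq_append_right:
  assumes "fp_eq A B v w" "a \<in> fp_words A B"
  shows "fp_eq A B (v @ a) (w @ a)"
  using assms(1)
proof induction
  case (refl w)
  then show ?case using assms(2) by (intro fp_eq.refl) auto
next
  case (oneL u v)
  then show ?case using fp_eq.oneL[of u A B "v @ a"] assms(2) by auto
next
  case (oneR u v)
  then show ?case using fp_eq.oneR[of u A B "v @ a"] assms(2) by auto
next
  case (multL u v x y)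
  then show ?case using fp_eq.multL[of u A B "v @ a" x y] assms(2) by auto
next
  case (multR u v x y)
  then show ?case using fp_eq.multR[of u A B "v @ a" x y] assms(2) by auto
qed (erule fp_eq.sym, erule (1) fp_eq.trans)

lemma fp_eq_append:
  assumes "group A" "group B" "fp_eq A B v v'" "fp_eq A B w w'"
  shows "fp_eq A B (v @ w) (v' @ w')"
proof (rule fp_eq.trans)
  show "fp_eq A B (v @ w) (v' @ w)"
    using fp_eq_append_right[OF assms(3)] fp_eq_words[OF assms(1,2,4)] by blast
  show "fp_eq A B (v' @ w) (v' @ w')"
    using fp_eq_append_left[OF assms(4)] fp_eq_words[OF assms(1-3)] by blast
qed

lemma fp_class_mult:
  assumes "group A" "group B" "v \<in> fp_words A B" "w \<in> fp_words A B"
  shows "fp_rel A B `` {v} \<otimes>\<^bsub>free_product A B\<^esub> fp_rel A B `` {w} = fp_rel A B `` {v @ w}"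
proof -
  have "fp_rel A B `` {a @ b} = fp_rel A B `` {v @ w}"
    if "fp_eq A B v a" "fp_eq A B w b" for a b
  proof -
    have "(v @ w, a @ b) \<in> fp_rel A B"
      using fp_eq_append[OF assms(1,2) that] by (simp add: fp_rel_def)
    then show ?thesis
      using equiv_class_eq[OF equiv_fp_rel[OF assms(1,2)]] by blast
  qed
  moreover have "fp_eq A B v v" "fp_eq A B w w"
    using assms(3,4) by (simp_all only: fp_eq.refl)
  ultimately have "(\<Union>a\<in>{a. fp_eq A B v a}. \<Union>b\<in>{b. fp_eq A B w b}. fp_rel A B `` {a @ b})
      = fp_rel A B `` {v @ w}"
    by blast
  moreover have "fp_rel A B `` {v} = {a. fp_eq A B v a}" "fp_rel A B `` {w} = {b. fp_eq A B w b}"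
    by (simp_all add: fp_rel_def)
  ultimately show ?thesis by (simp add: free_product_def)
qed

lemma fp_word_inverse:
  assumes "group A" "group B" "w \<in> fp_words A B"
  shows "\<exists>v\<in>fp_words A B. fp_eq A B (v @ w) []"
  using assms(3)
proof (induction w)
  case Nil
  have "fp_eq A B ([] @ []) []" by (simp add: fp_eq.refl)
  then show ?case by (rule bexI) simp
next
  case (Cons a w)
  interpret A: group A by fact
  interpret B: group B by fact
  from Cons obtain v where v: "v \<in> fp_words A B" "fp_eq A B (v @ w) []" by auto
  have w: "w \<in> fp_words A B" using Cons by simp
  have "\<exists>b\<in>carrier A <+> carrier B. fp_eq A B (v @ [b, a] @ w) (v @ w)"
  proof (cases a)
    case (Inl x)
    then have x: "x \<in> carrier A" using Cons by auto
    have "fp_eq A B (v @ [Inl (inv\<^bsub>A\<^esub> x), Inl x] @ w) (v @ [Inl \<one>\<^bsub>A\<^esub>] @ w)"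
      using fp_eq.multL[OF v(1) w, of "inv\<^bsub>A\<^esub> x" x] x by simp
    then have "fp_eq A B (v @ [Inl (inv\<^bsub>A\<^esub> x), a] @ w) (v @ w)"
      unfolding Inl using fp_eq.oneL[OF v(1) w] by (rule fp_eq.trans)
    then show ?thesis by (rule bexI) (simp add: InlI x)
  next
    case (Inr x)
    then have x: "x \<in> carrier B" using Cons by auto
    have "fp_eq A B (v @ [Inr (inv\<^bsub>B\<^esub> x), Inr x] @ w) (v @ [Inr \<one>\<^bsub>B\<^esub>] @ w)"
      using fp_eq.multR[OF v(1) w, of "inv\<^bsub>B\<^esub> x" x] x by simp
    then have "fp_eq A B (v @ [Inr (inv\<^bsub>B\<^esub> x), a] @ w) (v @ w)"
      unfolding Inr using fp_eq.oneR[OF v(1) w] by (rule fp_eq.trans)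
    then show ?thesis by (rule bexI) (simp add: InrI x)
  qed
  then obtain b where b: "b \<in> carrier A <+> carrier B" "fp_eq A B (v @ [b, a] @ w) (v @ w)" by blast
  have "fp_eq A B ((v @ [b]) @ a # w) []"
    using fp_eq.trans[OF b(2) v(2)] by simp
  moreover have "v @ [b] \<in> fp_words A B" using v(1) b(1) by simp
  ultimately show ?case by blast
qed

lemma fp_carrier: "carrier (free_product A B) = fp_words A B // fp_rel A B"
  by (simp add: free_product_def)

lemma fp_one: "\<one>\<^bsub>free_product A B\<^esub> = fp_rel A B `` {[]}"
  by (simp add: free_product_def)

lemma fp_class_in_carrier:
  "w \<in> fp_words A B \<Longrightarrow> fp_rel A B `` {w} \<in> carrier (free_product A B)"
  by (simp add: fp_carrier quotientI del: in_lists_conv_set)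

lemma fp_carrierE:
  assumes "X \<in> carrier (free_product A B)"
  obtains w where "w \<in> fp_words A B" "X = fp_rel A B `` {w}"
  using assms unfolding fp_carrier by (rule quotientE)

theorem group_free_product:
  assumes "group A" "group B"
  shows "group (free_product A B)"
proof (rule groupI)
  note [simp del] = in_lists_conv_set
  have app: "v @ w \<in> fp_words A B" if "v \<in> fp_words A B" "w \<in> fp_words A B" for v w
    using that by simp
  note m = fp_class_mult[OF assms]
  show "X \<otimes>\<^bsub>free_product A B\<^esub> Y \<in> carrier (free_product A B)"
    if XY: "X \<in> carrier (free_product A B)" "Y \<in> carrier (free_product A B)" for X Y
  proof -
    obtain v where v: "v \<in> fp_words A B" "X = fp_rel A B `` {v}"
      using XY(1) by (rule fp_carrierE)
    obtain w where w: "w \<in> fp_words A B" "Y = fp_rel A B `` {w}"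
      using XY(2) by (rule fp_carrierE)
    show ?thesis
      unfolding v(2) w(2) m[OF v(1) w(1)] using app[OF v(1) w(1)] by (rule fp_class_in_carrier)
  qed
  show "\<one>\<^bsub>free_product A B\<^esub> \<in> carrier (free_product A B)"
    unfolding fp_one by (rule fp_class_in_carrier) simp
  show "X \<otimes>\<^bsub>free_product A B\<^esub> Y \<otimes>\<^bsub>free_product A B\<^esub> Z
      = X \<otimes>\<^bsub>free_product A B\<^esub> (Y \<otimes>\<^bsub>free_product A B\<^esub> Z)"
    if XYZ: "X \<in> carrier (free_product A B)" "Y \<in> carrier (free_product A B)"
      "Z \<in> carrier (free_product A B)" for X Y Z
  proof -
    obtain u where u: "u \<in> fp_words A B" "X = fp_rel A B `` {u}"
      using XYZ(1) by (rule fp_carrierE)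
    obtain v where v: "v \<in> fp_words A B" "Y = fp_rel A B `` {v}"
      using XYZ(2) by (rule fp_carrierE)
    obtain w where w: "w \<in> fp_words A B" "Z = fp_rel A B `` {w}"
      using XYZ(3) by (rule fp_carrierE)
    show ?thesis
      unfolding u(2) v(2) w(2) m[OF u(1) v(1)] m[OF v(1) w(1)]
        m[OF app[OF u(1) v(1)] w(1)] m[OF u(1) app[OF v(1) w(1)]] by simp
  qed
  show "\<one>\<^bsub>free_product A B\<^esub> \<otimes>\<^bsub>free_product A B\<^esub> X = X"
    if X: "X \<in> carrier (free_product A B)" for X
  proof -
    obtain w where "w \<in> fp_words A B" "X = fp_rel A B `` {w}"
      using X by (rule fp_carrierE)
    then show ?thesis using m[of "[]" w] by (simp add: fp_one)
  qed
  show "\<exists>Y\<in>carrier (free_product A B). Y \<otimes>\<^bsub>free_product A B\<^esub> X = \<one>\<^bsub>free_product A B\<^esub>"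
    if X: "X \<in> carrier (free_product A B)" for X
  proof -
    obtain w where w: "w \<in> fp_words A B" "X = fp_rel A B `` {w}"
      using X by (rule fp_carrierE)
    obtain v where v: "v \<in> fp_words A B" "fp_eq A B (v @ w) []"
      using fp_word_inverse[OF assms w(1)] by blast
    have "(v @ w, []) \<in> fp_rel A B" using v(2) by (simp add: fp_rel_def)
    then have "fp_rel A B `` {v @ w} = fp_rel A B `` {[]}"
      by (rule equiv_class_eq[OF equiv_fp_rel[OF assms]])
    then show ?thesis
      using m[OF v(1) w(1)] w v fp_class_in_carrier[OF v(1)] by (auto simp: fp_one)
  qed
qed

theorem free_product_universal:
  assumes "group A" "group B" "group K" "f \<in> hom A K" "g \<in> hom B K"
  shows "\<exists>h\<in>hom (free_product A B) K.
    (\<forall>x\<in>carrier A. h (fp_rel A B `` {[Inl x]}) = f x) \<and>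
    (\<forall>y\<in>carrier B. h (fp_rel A B `` {[Inr y]}) = g y)"
proof -
  interpret A: group A by fact
  interpret B: group B by fact
  interpret K: group K by fact
  have fg: "x \<in> carrier A \<Longrightarrow> f x \<in> carrier K" "y \<in> carrier B \<Longrightarrow> g y \<in> carrier K" for x y
    using assms(4,5) by (auto simp: hom_def)
  have one: "f \<one>\<^bsub>A\<^esub> = \<one>\<^bsub>K\<^esub>" "g \<one>\<^bsub>B\<^esub> = \<one>\<^bsub>K\<^esub>"
    using assms by (auto intro: hom_one)
  define ev where "ev = (\<lambda>w. foldr (\<lambda>a k. case_sum f g a \<otimes>\<^bsub>K\<^esub> k) w \<one>\<^bsub>K\<^esub>)"
  have [simp]: "ev [] = \<one>\<^bsub>K\<^esub>" "\<And>a w. ev (a # w) = case_sum f g a \<otimes>\<^bsub>K\<^esub> ev w"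
    by (simp_all add: ev_def)
  have letter: "case_sum f g a \<in> carrier K" if "a \<in> carrier A <+> carrier B" for a
    using that fg by auto
  have cl: "ev w \<in> carrier K" if "w \<in> fp_words A B" for w
    using that by (induction w) (auto simp: fg)
  have app: "ev (v @ w) = ev v \<otimes>\<^bsub>K\<^esub> ev w" if "v \<in> fp_words A B" "w \<in> fp_words A B" for v w
    using that(1)
  proof (induction v)
    case Nil
    then show ?case using cl[OF that(2)] by simp
  next
    case (Cons a v)
    then have "a \<in> carrier A <+> carrier B" "v \<in> fp_words A B" by simp_all
    then show ?case
      using Cons.IH letter[of a] cl[of v] cl[OF that(2)] by (simp add: K.m_assoc)
  qed
  have ev_eq: "ev v = ev w" if "fp_eq A B v w" for v w
    using that
  proof induction
    case (oneL u v)
    then show ?case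
      using app[of u v] app[of u "Inl \<one>\<^bsub>A\<^esub> # v"] cl[of v] by (simp add: one InlI)
  next
    case (oneR u v)
    then show ?case
      using app[of u v] app[of u "Inr \<one>\<^bsub>B\<^esub> # v"] cl[of v] by (simp add: one InrI)
  next
    case (multL u v x y)
    then show ?case
      using app[of u "Inl x # Inl y # v"] app[of u "Inl (x \<otimes>\<^bsub>A\<^esub> y) # v"] cl[of v] assms(4) fg
      by (simp add: hom_mult K.m_assoc InlI InrI)
  next
    case (multR u v x y)
    then show ?case
      using app[of u "Inr x # Inr y # v"] app[of u "Inr (x \<otimes>\<^bsub>B\<^esub> y) # v"] cl[of v] assms(5) fg
      by (simp add: hom_mult K.m_assoc InlI InrI)
  qed simp_all
  define h where "h = (\<lambda>X. ev (SOME w. w \<in> X))"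
  have h: "h (fp_rel A B `` {w}) = ev w" if "w \<in> fp_words A B" for w
  proof -
    have "w \<in> fp_rel A B `` {w}"
      using fp_eq.refl[OF that] by (simp add: fp_rel_def)
    then have "(SOME v. v \<in> fp_rel A B `` {w}) \<in> fp_rel A B `` {w}" by (rule someI)
    then have "fp_eq A B w (SOME v. v \<in> fp_rel A B `` {w})" by (simp add: fp_rel_def)
    then show ?thesis unfolding h_def by (rule ev_eq[symmetric])
  qed
  have "h \<in> hom (free_product A B) K"
  proof (rule homI)
    show "h X \<in> carrier K" if X: "X \<in> carrier (free_product A B)" for X
    proof -
      obtain w where w: "w \<in> fp_words A B" "X = fp_rel A B `` {w}"
        using X by (rule fp_carrierE)
      show ?thesis unfolding w(2) h[OF w(1)] by (rule cl[OF w(1)])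
    qed
    show "h (X \<otimes>\<^bsub>free_product A B\<^esub> Y) = h X \<otimes>\<^bsub>K\<^esub> h Y"
      if XY: "X \<in> carrier (free_product A B)" "Y \<in> carrier (free_product A B)" for X Y
    proof -
      obtain v where v: "v \<in> fp_words A B" "X = fp_rel A B `` {v}"
        using XY(1) by (rule fp_carrierE)
      obtain w where w: "w \<in> fp_words A B" "Y = fp_rel A B `` {w}"
        using XY(2) by (rule fp_carrierE)
      have vw: "v @ w \<in> fp_words A B" using v(1) w(1) by simp
      show ?thesis
        unfolding v(2) w(2) fp_class_mult[OF assms(1,2) v(1) w(1)] h[OF v(1)] h[OF w(1)] h[OF vw]
        by (rule app[OF v(1) w(1)])
    qed
  qed
  moreover have "h (fp_rel A B `` {[Inl x]}) = f x" if "x \<in> carrier A" for x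
    using h[of "[Inl x]"] that fg by auto
  moreover have "h (fp_rel A B `` {[Inr y]}) = g y" if "y \<in> carrier B" for y
    using h[of "[Inr y]"] that fg by auto
  ultimately show ?thesis by blast
qed


section \<open>The free product of two cyclic groups of order four\<close>

text \<open>
  A word is a list of letters: \<open>Inl k\<close> stands for the \<open>k\<close>-th power of the first generator and
  \<open>Inr k\<close> for the \<open>k\<close>-th power of the second one, where \<open>0 \<le> k < 4\<close>. An element of \<open>GG\<close> is the
  set of all words that represent it; inverses of generators are third powers.
\<close>

abbreviation Z4 :: "int monoid" where "Z4 \<equiv> integer_mod_group 4"

definition GG :: "(int + int) list set monoid" where "GG = free_product Z4 Z4"

definition gen1 :: "(int + int) list set" where "gen1 = fp_rel Z4 Z4 `` {[Inl 1]}"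
definition gen2 :: "(int + int) list set" where "gen2 = fp_rel Z4 Z4 `` {[Inr 1]}"

definition total_exponent :: "(int + int) list \<Rightarrow> int" where
  "total_exponent w = (\<Sum>a\<leftarrow>w. case a of Inl k \<Rightarrow> k | Inr k \<Rightarrow> k)"

definition GG0 :: "(int + int) list set set" where
  "GG0 = {g \<in> carrier GG. \<forall>w\<in>g. 4 dvd total_exponent w}"

lemma total_exponent_simps [simp]:
  "total_exponent [] = 0"
  "total_exponent (Inl k # w) = k + total_exponent w"
  "total_exponent (Inr k # w) = k + total_exponent w"
  "total_exponent (v @ w) = total_exponent v + total_exponent w"
  by (simp_all add: total_exponent_def)

lemma mod4: "(a + (x + (y + b))) mod 4 = (a + ((x + y) mod 4 + b)) mod 4" for a b x y :: int
proof -
  have "(a + ((x + y) mod 4 + b)) mod 4 = ((x + y) mod 4 + (a + b)) mod 4"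
    by (simp only: ac_simps)
  also have "\<dots> = ((x + y) + (a + b)) mod 4" by (rule mod_add_left_eq)
  also have "(x + y) + (a + b) = a + (x + (y + b))" by (simp only: ac_simps)
  finally show ?thesis by (rule HOL.sym)
qed

lemma fp_eq_total_exponent:
  "fp_eq Z4 Z4 v w \<Longrightarrow> total_exponent v mod 4 = total_exponent w mod 4"
proof (induction rule: fp_eq.induct)
  case (refl w)
  show ?case ..
next
  case (sym v w)
  show ?case using sym.IH[symmetric] .
next
  case (trans u v w)
  show ?case using trans.IH by (rule HOL.trans)
next
  case (oneL u v)
  show ?case by simp
next
  case (oneR u v)
  show ?case by simp
next
  case (multL u v x y)
  show ?case
    using mod4[of "total_exponent u" x y "total_exponent v"]
    by (simp only: total_exponent_simps append_Cons append_Nil mult_integer_mod_group of_nat_numeral)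
next
  case (multR u v x y)
  show ?case
    using mod4[of "total_exponent u" x y "total_exponent v"]
    by (simp only: total_exponent_simps append_Cons append_Nil mult_integer_mod_group of_nat_numeral)
qed

lemma GG0_iff:
  assumes g: "g \<in> carrier GG" "w \<in> g"
  shows "g \<in> GG0 \<longleftrightarrow> 4 dvd total_exponent w"
proof -
  have eq: "equiv (fp_words Z4 Z4) (fp_rel Z4 Z4)"
    by (rule equiv_fp_rel[OF group_integer_mod_group group_integer_mod_group])
  have "4 dvd total_exponent v \<longleftrightarrow> 4 dvd total_exponent w" if "v \<in> g" for v
  proof -
    have "{v, w} \<subseteq> g" using that g(2) by simp
    then have "(v, w) \<in> fp_rel Z4 Z4"
      by (rule in_quotient_imp_in_rel[OF eq g(1)[unfolded GG_def fp_carrier]])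
    then have "fp_eq Z4 Z4 v w" by (simp add: fp_rel_def)
    then have "total_exponent v mod 4 = total_exponent w mod 4" by (rule fp_eq_total_exponent)
    then show ?thesis by (simp only: dvd_eq_mod_eq_0)
  qed
  then show ?thesis using g unfolding GG0_def by blast
qed

definition Isom :: "(complex \<Rightarrow> complex) monoid" where
  "Isom = \<lparr>carrier = {f. surj f \<and> (\<forall>x y. dist (f x) (f y) = dist x y)},
           monoid.mult = (\<circ>), one = id\<rparr>"

text \<open>Counterclockwise rotation by the angle \<open>t\<close> about \<open>c\<close>.\<close>

definition rot :: "real \<Rightarrow> complex \<Rightarrow> complex \<Rightarrow> complex" where
  "rot t c p = c + cis t * (p - c)"

lemma group_Isom: "group Isom"
proof (rule groupI)
  show "f \<otimes>\<^bsub>Isom\<^esub> g \<in> carrier Isom" if "f \<in> carrier Isom" "g \<in> carrier Isom" for f g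
    using that comp_surj[of g f] by (simp add: Isom_def)
  show "\<exists>g\<in>carrier Isom. g \<otimes>\<^bsub>Isom\<^esub> f = \<one>\<^bsub>Isom\<^esub>" if f: "f \<in> carrier Isom" for f
  proof -
    have "inj f"
    proof (rule injI)
      fix x y assume "f x = f y"
      then have "dist (f x) (f y) = 0" by simp
      moreover have "dist (f x) (f y) = dist x y" using f by (simp add: Isom_def)
      ultimately show "x = y" by simp
    qed
    then have "inv_into UNIV f \<circ> f = id" by simp
    moreover have "surj (inv_into UNIV f)" using \<open>inj f\<close> by (rule inj_imp_surj_inv)
    moreover have "dist (inv_into UNIV f x) (inv_into UNIV f y) = dist x y" for x y
    proof -
      have "surj f" "dist (f (inv_into UNIV f x)) (f (inv_into UNIV f y))
          = dist (inv_into UNIV f x) (inv_into UNIV f y)"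
        using f by (simp_all add: Isom_def)
      then show ?thesis by (simp add: surj_f_inv_f)
    qed
    ultimately show ?thesis by (auto simp: Isom_def)
  qed
qed (simp_all add: Isom_def comp_assoc)

lemma rot_Isom: "rot t c \<in> carrier Isom"
proof -
  have "rot t c (rot (- t) c p) = p" for p
  proof -
    have "rot t c (rot (- t) c p) = c + (cis t * cis (- t)) * (p - c)"
      by (simp add: rot_def algebra_simps)
    then show ?thesis by (simp add: cis_mult)
  qed
  then have "surj (rot t c)" by (metis surjI)
  moreover have "dist (rot t c x) (rot t c y) = dist x y" for x y
  proof -
    have "rot t c x - rot t c y = cis t * (x - y)" by (simp add: rot_def algebra_simps)
    then show ?thesis by (simp add: dist_norm norm_mult)
  qed
  ultimately show ?thesis by (simp add: Isom_def)
qed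

lemma rot_hom: "(\<lambda>k. rot (of_int k * (pi / 2)) c) \<in> hom Z4 Isom"
proof (rule homI)
  fix x y :: int
  have "of_int (x + y) * (pi / 2) = of_int ((x + y) mod 4) * (pi / 2) + of_int ((x + y) div 4) * (2 * pi)"
  proof -
    have "real_of_int (x + y) = of_int ((x + y) mod 4) + 4 * of_int ((x + y) div 4)"
      by (metis add.commute mult_div_mod_eq of_int_add of_int_mult of_int_numeral)
    then show ?thesis by (simp add: algebra_simps)
  qed
  then have "cis (of_int (x + y) * (pi / 2))
      = cis (of_int ((x + y) mod 4) * (pi / 2)) * cis (2 * pi * of_int ((x + y) div 4))"
    by (simp only: cis_mult mult.commute add.commute)
  moreover have "cis (2 * pi * of_int ((x + y) div 4)) = 1"
    by (rule cis_multiple_2pi) simp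
  moreover have "cis (of_int x * (pi / 2)) * cis (of_int y * (pi / 2)) = cis (of_int (x + y) * (pi / 2))"
    by (simp only: cis_mult of_int_add distrib_right)
  ultimately have c: "cis (of_int ((x + y) mod 4) * (pi / 2))
      = cis (of_int x * (pi / 2)) * cis (of_int y * (pi / 2))"
    by simp
  show "rot (of_int (x \<otimes>\<^bsub>Z4\<^esub> y) * (pi / 2)) c
      = rot (of_int x * (pi / 2)) c \<otimes>\<^bsub>Isom\<^esub> rot (of_int y * (pi / 2)) c"
    using c by (auto simp: fun_eq_iff rot_def Isom_def)
qed (rule rot_Isom)

theorem ex_hom_GG_Isom:
  "\<exists>H\<in>hom GG Isom. H gen1 = rot (pi / 2) 0 \<and> H gen2 = rot (pi / 2) 1"
proof -
  have 1: "1 \<in> carrier Z4" by simp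
  obtain H where "H \<in> hom (free_product Z4 Z4) Isom"
    and "\<forall>k\<in>carrier Z4. H (fp_rel Z4 Z4 `` {[Inl k]}) = rot (of_int k * (pi / 2)) 0"
    and "\<forall>k\<in>carrier Z4. H (fp_rel Z4 Z4 `` {[Inr k]}) = rot (of_int k * (pi / 2)) 1"
    using free_product_universal[OF group_integer_mod_group group_integer_mod_group group_Isom
        rot_hom[of 0] rot_hom[of 1]] by blast
  moreover from this(2,3)[rule_format, OF 1]
  have "H gen1 = rot (pi / 2) 0" "H gen2 = rot (pi / 2) 1"
    unfolding gen1_def gen2_def by simp_all
  ultimately show ?thesis unfolding GG_def by blast
qed


section \<open>Square turning maps\<close>

text \<open>The squares of the grid are indexed by pairs of integers.\<close>

definition grid_square :: "real \<Rightarrow> complex \<Rightarrow> int \<Rightarrow> int \<Rightarrow> complex set" where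
  "grid_square s z m n =
    cbox (z + of_real s * Complex (of_int m) (of_int n))
         (z + of_real s * Complex (of_int m + 1) (of_int n + 1))"

definition square_center :: "real \<Rightarrow> complex \<Rightarrow> int \<Rightarrow> int \<Rightarrow> complex" where
  "square_center s z m n = z + of_real s * Complex (of_int m + 1/2) (of_int n + 1/2)"

definition turn :: "real \<Rightarrow> complex \<Rightarrow> complex \<rightharpoonup> complex" where
  "turn s z p =
    (if \<exists>m n. p \<in> interior (grid_square s z m n)
     then let c = (THE c. \<exists>m n. p \<in> interior (grid_square s z m n) \<and> c = square_center s z m n)
          in Some (rot (- pi / 2) c p)
     else None)"

lemma turn_eq:
  assumes "s > 0" "p \<in> interior (grid_square s z m n)"
  shows "turn s z p = Some (rot (- pi / 2) (square_center s z m n) p)"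
proof -
  have uniq: "i = m \<and> j = n" if "p \<in> interior (grid_square s z i j)" for i j
  proof -
    have *: "a = b" if "s * real_of_int a < t" "t < s * (real_of_int b + 1)"
      "s * real_of_int b < t" "t < s * (real_of_int a + 1)" for a b :: int and t
    proof -
      have "s * real_of_int a < s * (real_of_int b + 1)" "s * real_of_int b < s * (real_of_int a + 1)"
        using that by linarith+
      then have "real_of_int a < real_of_int b + 1" "real_of_int b < real_of_int a + 1"
        using assms(1) by simp_all
      then show ?thesis by linarith
    qed
    from that assms(2) show ?thesis
      using *[of i "Re p - Re z" m] *[of j "Im p - Im z" n]
      by (auto simp: grid_square_def interior_cbox in_box_complex_iff algebra_simps)
  qed
  have "(THE c. \<exists>m n. p \<in> interior (grid_square s z m n) \<and> c = square_center s z m n)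
      = square_center s z m n"
    using assms(2) uniq by (intro the_equality) blast+
  moreover have "\<exists>m n. p \<in> interior (grid_square s z m n)" using assms(2) by blast
  ultimately show ?thesis unfolding turn_def Let_def by (simp only: if_True)
qed

definition pfun_pow :: "(complex \<rightharpoonup> complex) \<Rightarrow> nat \<Rightarrow> complex \<rightharpoonup> complex" where
  "pfun_pow f n = (((\<circ>\<^sub>m) f) ^^ n) Some"

text \<open>
  The partial map of a word; as in a product of group elements the rightmost letter acts first.
  Words that represent the same group element may give maps with different domains
  (they may differ by grid lines and their images), hence it is a function of the word.
\<close>

fun word_map :: "real \<Rightarrow> complex \<Rightarrow> (int + int) list \<Rightarrow> complex \<rightharpoonup> complex" where
  "word_map s z [] = Some"
| "word_map s z (Inl k # w) = pfun_pow (turn 1 0) (nat k) \<circ>\<^sub>m word_map s z w"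
| "word_map s z (Inr k # w) = pfun_pow (turn s z) (nat k) \<circ>\<^sub>m word_map s z w"


section \<open>Density and periodic islands\<close>

definition positive_density :: "complex set \<Rightarrow> bool" where
  "positive_density E \<longleftrightarrow>
    Liminf at_top (\<lambda>r::real. ereal (measure lebesgue (E \<inter> ball 0 r) / (pi * r\<^sup>2))) > 0"

definition fixed_points :: "(complex \<rightharpoonup> complex) \<Rightarrow> complex set" where
  "fixed_points f = {p. f p = Some p}"

definition periodic_point :: "(complex \<rightharpoonup> complex) \<Rightarrow> complex \<Rightarrow> bool" where
  "periodic_point f p \<longleftrightarrow> (\<exists>n>0. pfun_pow f n p = Some p)"

definition period :: "(complex \<rightharpoonup> complex) \<Rightarrow> complex \<Rightarrow> nat" where
  "period f p = (LEAST n. n > 0 \<and> pfun_pow f n p = Some p)"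

text \<open>Polygons are nondegenerate and bounded.\<close>

definition open_convex_polygon :: "complex set \<Rightarrow> bool" where
  "open_convex_polygon P \<longleftrightarrow> P \<noteq> {} \<and> (\<exists>Q. polytope Q \<and> P = interior Q)"

text \<open>
  Periodicity at every point of the polygon includes that all iterates are defined there.
  ``The maximal'' polygon is read as the greatest one with respect to inclusion.
\<close>

definition is_periodic_island :: "(complex \<rightharpoonup> complex) \<Rightarrow> complex \<Rightarrow> complex set \<Rightarrow> bool" where
  "is_periodic_island f p P \<longleftrightarrow>
    (let admissible = (\<lambda>Q. open_convex_polygon Q \<and> p \<in> Q \<and> (\<forall>q\<in>Q. periodic_point f q))
     in admissible P \<and> (\<forall>Q. admissible Q \<longrightarrow> Q \<subseteq> P))"

definition islands_of_period :: "(complex \<rightharpoonup> complex) \<Rightarrow> nat \<Rightarrow> complex set set" where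
  "islands_of_period f n =
    {P. \<exists>p. periodic_point f p \<and> period f p = n \<and> is_periodic_island f p P}"

end

theory Submission
  imports Defs
begin

text \<open>
  If a unit square and a square of the second grid have centers \<open>c\<close> and \<open>d\<close> that are close to each
  other, then a point near \<open>c\<close> stays in these two squares throughout the word, so the word acts there
  as the corresponding product of clockwise rotations about \<open>c\<close> and \<open>d\<close>. Up to an
  orientation-reversing similarity this product is the value of \<open>H\<close>, hence the identity, and a small
  disc of fixed points appears. As \<open>s\<close> is irrational, such pairs of centers are relatively dense in
  the plane, which gives positive density. The component of the domain that contains a fixed point is
  an intersection of squares, on which the map is a translation fixing a point; so this rectangle is
  the island. Finitely many bounded islands cannot cover an unbounded set of fixed points.
\<close>

section \<open>Words as sequences of quarter turns\<close>

fun word_turns :: "(int + int) list \<Rightarrow> bool list" where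
  "word_turns [] = []"
| "word_turns (Inl k # w) = replicate (nat k) False @ word_turns w"
| "word_turns (Inr k # w) = replicate (nat k) True @ word_turns w"

fun turn_seq :: "real \<Rightarrow> complex \<Rightarrow> bool list \<Rightarrow> complex \<rightharpoonup> complex" where
  "turn_seq s z [] = Some"
| "turn_seq s z (b # bs) = (if b then turn s z else turn 1 0) \<circ>\<^sub>m turn_seq s z bs"

fun rot_seq :: "real \<Rightarrow> complex \<Rightarrow> complex \<Rightarrow> bool list \<Rightarrow> complex \<Rightarrow> complex" where
  "rot_seq t c d [] = id"
| "rot_seq t c d (b # bs) = rot t (if b then d else c) \<circ> rot_seq t c d bs"

lemma pfun_pow_Suc: "pfun_pow f (Suc n) = f \<circ>\<^sub>m pfun_pow f n"
  by (simp add: pfun_pow_def)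

lemma pfun_pow_0_comp: "pfun_pow f 0 \<circ>\<^sub>m g = g"
  by (rule ext) (simp add: pfun_pow_def map_comp_def split: option.split)

lemma map_comp_assoc: "(f \<circ>\<^sub>m g) \<circ>\<^sub>m h = f \<circ>\<^sub>m (g \<circ>\<^sub>m h)"
  by (rule ext) (simp add: map_comp_def split: option.split)

lemma turn_seq_replicate:
  "turn_seq s z (replicate n b @ bs) =
    pfun_pow (if b then turn s z else turn 1 0) n \<circ>\<^sub>m turn_seq s z bs"
  by (induction n) (simp_all add: pfun_pow_0_comp pfun_pow_Suc map_comp_assoc)

lemma word_map_eq_turn_seq: "word_map s z w = turn_seq s z (word_turns w)"
  by (induction w rule: word_turns.induct) (simp_all add: turn_seq_replicate)

lemma rot_seq_append: "rot_seq t c d (as @ bs) = rot_seq t c d as \<circ> rot_seq t c d bs"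
  by (induction as) (simp_all add: comp_assoc)

lemma length_word_turns:
  assumes "w \<in> fp_words Z4 Z4"
  shows "int (length (word_turns w)) = total_exponent w"
  using assms by (induction w rule: word_turns.induct) (auto simp: carrier_integer_mod_group)

lemma fp_class_eqI:
  assumes "fp_eq Z4 Z4 v w"
  shows "fp_rel Z4 Z4 `` {v} = fp_rel Z4 Z4 `` {w}"
  using assms
  by (intro equiv_class_eq[OF equiv_fp_rel[OF group_integer_mod_group group_integer_mod_group]])
     (simp add: fp_rel_def)

lemma hom_GG_letter:
  assumes H: "H \<in> hom GG Isom"
    and X: "X = (if b then Inr else Inl)"
    and gen: "H (fp_rel Z4 Z4 `` {[X 1]}) = rot (pi / 2) (if b then 1 else 0)"
    and w: "w \<in> fp_words Z4 Z4" and n: "n < 4"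
  shows "H (fp_rel Z4 Z4 `` {X (int n) # w}) =
    rot_seq (pi / 2) 0 1 (replicate n b) \<circ> H (fp_rel Z4 Z4 `` {w})"
  using n
proof (induction n)
  case 0
  have "fp_eq Z4 Z4 (X 0 # w) w"
    using fp_eq.oneL[of "[]" Z4 Z4 w] fp_eq.oneR[of "[]" Z4 Z4 w] w X
    by (cases b) simp_all
  then show ?case by (simp add: fp_class_eqI)
next
  case (Suc n)
  have Z4: "1 \<in> carrier Z4" "int n \<in> carrier Z4" "1 \<otimes>\<^bsub>Z4\<^esub> int n = int (Suc n)"
    using Suc.prems by (simp_all add: carrier_integer_mod_group)
  have letter: "X k \<in> carrier Z4 <+> carrier Z4" if "k \<in> carrier Z4" for k
    using that by (cases b) (simp_all only: X if_True if_False InlI InrI)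
  have nw: "X (int n) # w \<in> fp_words Z4 Z4" and one: "[X 1] \<in> fp_words Z4 Z4"
    using letter[OF Z4(1)] letter[OF Z4(2)] w by (simp_all only: Cons_in_lists_iff lists.Nil simp_thms)
  have "fp_eq Z4 Z4 ([] @ [X 1, X (int n)] @ w) ([] @ [X (1 \<otimes>\<^bsub>Z4\<^esub> int n)] @ w)"
    unfolding X using w Z4(1,2) by (cases b) (simp_all only: if_True if_False fp_eq.multL fp_eq.multR lists.Nil)
  then have "fp_eq Z4 Z4 (X 1 # X (int n) # w) (X (int (Suc n)) # w)"
    by (simp only: Z4(3) append_Nil append_Cons)
  then have "fp_rel Z4 Z4 `` {X (int (Suc n)) # w} = fp_rel Z4 Z4 `` {[X 1] @ X (int n) # w}"
    by (simp add: fp_class_eqI)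
  also have "\<dots> = fp_rel Z4 Z4 `` {[X 1]} \<otimes>\<^bsub>GG\<^esub> fp_rel Z4 Z4 `` {X (int n) # w}"
    unfolding GG_def
    by (rule fp_class_mult[symmetric, OF group_integer_mod_group group_integer_mod_group one nw])
  finally have "H (fp_rel Z4 Z4 `` {X (int (Suc n)) # w}) =
      H (fp_rel Z4 Z4 `` {[X 1]}) \<circ> H (fp_rel Z4 Z4 `` {X (int n) # w})"
    using hom_mult[OF H, of "fp_rel Z4 Z4 `` {[X 1]}" "fp_rel Z4 Z4 `` {X (int n) # w}"]
      fp_class_in_carrier[OF one] fp_class_in_carrier[OF nw]
    by (simp add: GG_def Isom_def)
  then show ?case using Suc gen by (cases b) (simp_all add: comp_assoc)
qed

lemma hom_GG_word:
  assumes H: "H \<in> hom GG Isom" and gen: "H gen1 = rot (pi / 2) 0" "H gen2 = rot (pi / 2) 1"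
    and w: "w \<in> fp_words Z4 Z4"
  shows "H (fp_rel Z4 Z4 `` {w}) = rot_seq (pi / 2) 0 1 (word_turns w)"
  using w
proof (induction w rule: word_turns.induct)
  case 1
  have "H \<one>\<^bsub>GG\<^esub> = \<one>\<^bsub>Isom\<^esub>"
    using hom_one[OF H _ group_Isom]
      group_free_product[OF group_integer_mod_group group_integer_mod_group]
    by (simp add: GG_def)
  then show ?case by (simp add: GG_def fp_one Isom_def)
next
  case (2 k w)
  then have "0 \<le> k" "nat k < 4" "w \<in> fp_words Z4 Z4"
    by (auto simp: carrier_integer_mod_group)
  with 2(1) hom_GG_letter[OF H, of Inl False w "nat k"] gen(1) show ?case
    by (simp add: gen1_def rot_seq_append)
next
  case (3 k w)
  then have "0 \<le> k" "nat k < 4" "w \<in> fp_words Z4 Z4"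
    by (auto simp: carrier_integer_mod_group)
  with 3(1) hom_GG_letter[OF H, of Inr True w "nat k"] gen(2) show ?case
    by (simp add: gen2_def rot_seq_append)
qed

text \<open>
  Complex conjugation followed by the affine map that takes \<open>0, 1\<close> to \<open>c, d\<close> turns the
  counterclockwise rotations about \<open>0, 1\<close> into the clockwise ones about \<open>c, d\<close>. The relation is
  stated through coefficients so that it also covers \<open>c = d\<close>.
\<close>

lemma rot_seq_coefficients:
  assumes t: "cis t = - \<i>"
  shows "\<exists>a b. (\<forall>x. rot_seq (pi / 2) 0 1 bs x = a * x + b) \<and>
    (\<forall>p. rot_seq t c d bs p = c + cnj a * (p - c) + (d - c) * cnj b)"
proof (induction bs)
  case Nil
  show ?case by (rule exI[of _ 1], rule exI[of _ 0]) simp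
next
  case (Cons e bs)
  then obtain a b where ab: "\<And>x. rot_seq (pi / 2) 0 1 bs x = a * x + b"
    "\<And>p. rot_seq t c d bs p = c + cnj a * (p - c) + (d - c) * cnj b" by blast
  show ?case
  proof (cases e)
    case True
    show ?thesis
      by (rule exI[of _ "\<i> * a"], rule exI[of _ "1 + \<i> * (b - 1)"])
        (simp add: True ab rot_def t algebra_simps)
  next
    case False
    show ?thesis
      by (rule exI[of _ "\<i> * a"], rule exI[of _ "\<i> * b"])
        (simp add: False ab rot_def t algebra_simps)
  qed
qed

lemma rot_seq_id_transfer:
  assumes "rot_seq (pi / 2) 0 1 bs = id"
  shows "rot_seq (- pi / 2) c d bs = id"
proof -
  have "cis (- pi / 2) = - \<i>" by (simp add: complex_eq_iff)
  from rot_seq_coefficients[OF this, of bs c d]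
  obtain a b where ab: "\<And>x. rot_seq (pi / 2) 0 1 bs x = a * x + b"
    "\<And>p. rot_seq (- pi / 2) c d bs p = c + cnj a * (p - c) + (d - c) * cnj b" by blast
  have "b = 0" using ab(1)[of 0] assms by simp
  moreover have "a = 1" using ab(1)[of 1] assms \<open>b = 0\<close> by simp
  ultimately show ?thesis unfolding fun_eq_iff ab(2) by simp
qed


section \<open>Fixed points near a pair of close centers\<close>

lemma near_square_center:
  assumes "dist p (square_center s z m n) < s / 2"
  shows "p \<in> interior (grid_square s z m n)"
proof -
  let ?c = "square_center s z m n"
  have "\<bar>Re p - Re ?c\<bar> < s / 2" "\<bar>Im p - Im ?c\<bar> < s / 2"
    using assms abs_Re_le_cmod[of "p - ?c"] abs_Im_le_cmod[of "p - ?c"] by (auto simp: dist_norm)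
  then have "Re ?c - s / 2 < Re p" "Re p < Re ?c + s / 2" "Im ?c - s / 2 < Im p" "Im p < Im ?c + s / 2"
    by linarith+
  then show ?thesis
    by (simp add: grid_square_def square_center_def interior_cbox in_box_complex_iff algebra_simps)
qed

lemma dist_rot_center: "dist (rot t c p) c = dist p c"
  by (simp add: rot_def dist_norm norm_mult)

lemma turn_seq_near_centers:
  fixes \<delta> :: real
  assumes s: "s > 0"
    and c: "c = square_center 1 0 k l" and d: "d = square_center s z m n"
    and cd: "dist c d < \<delta>" and p: "dist p c < \<delta>"
    and small: "(2 * real (length bs) + 2) * \<delta> \<le> min 1 s / 2"
  shows "turn_seq s z bs p = Some (rot_seq (- pi / 2) c d bs p) \<and>
    dist (rot_seq (- pi / 2) c d bs p) c < (2 * real (length bs) + 1) * \<delta>"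
  using small
proof (induction bs)
  case Nil
  then show ?case using p by simp
next
  case (Cons b bs)
  let ?q = "rot_seq (- pi / 2) c d bs p"
  have \<delta>: "\<delta> > 0" using cd zero_le_dist[of c d] by linarith
  have sm: "(2 * real (length bs) + 2) * \<delta> + 2 * \<delta> \<le> min 1 s / 2"
    using Cons.prems by (simp add: algebra_simps)
  then have IH: "turn_seq s z bs p = Some ?q" "dist ?q c < (2 * real (length bs) + 1) * \<delta>"
    using Cons.IH \<delta> by auto
  have qd: "dist ?q d < (2 * real (length bs) + 2) * \<delta>"
    using IH(2) cd dist_triangle[of ?q d c] by (simp add: algebra_simps)
  show ?case
  proof (cases b)
    case True
    have "?q \<in> interior (grid_square s z m n)"
      by (rule near_square_center) (use qd sm \<delta> d in auto)
    then have "turn s z ?q = Some (rot (- pi / 2) d ?q)" using s d by (simp add: turn_eq)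
    moreover have "dist (rot (- pi / 2) d ?q) c < (2 * real (length bs) + 3) * \<delta>"
      using dist_triangle[of "rot (- pi / 2) d ?q" c d] dist_rot_center[of "- pi / 2" d ?q] qd cd
      by (simp add: algebra_simps dist_commute)
    ultimately show ?thesis using True IH by (simp add: algebra_simps)
  next
    case False
    have "?q \<in> interior (grid_square 1 0 k l)"
      by (rule near_square_center) (use IH(2) sm \<delta> c in \<open>auto simp: algebra_simps\<close>)
    then have "turn 1 0 ?q = Some (rot (- pi / 2) c ?q)" using c by (simp add: turn_eq)
    moreover have "dist (rot (- pi / 2) c ?q) c < (2 * real (length bs) + 3) * \<delta>"
      using dist_rot_center[of "- pi / 2" c ?q] IH(2) \<delta> by (simp add: algebra_simps)
    ultimately show ?thesis using False IH by (simp add: algebra_simps)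
  qed
qed


section \<open>Abundance of close centers\<close>

lemma irrational_multiples_near_integers:
  fixes s \<delta> :: real
  assumes s: "s \<notin> \<rat>" and \<delta>: "\<delta> > 0"
  shows "\<exists>L. \<forall>t. \<exists>m::nat. m \<le> L \<and> (\<exists>k::int. \<bar>t + s * real m - of_int k\<bar> < \<delta>)"
proof -
  define N where "N = nat \<lceil>1 / \<delta>\<rceil> + 1"
  have N: "N > 0" "1 / real N < \<delta>"
  proof -
    show "N > 0" by (simp add: N_def)
    have "1 / \<delta> < real N" unfolding N_def using \<delta> by linarith
    then show "1 / real N < \<delta>" using \<delta> \<open>N > 0\<close> by (simp add: field_simps)
  qed
  obtain h q where hq: "0 < q" "q \<le> int N" "\<bar>of_int q * s - of_int h\<bar> < 1 / real N"
    using Dirichlet_approx[OF N(1), of s] by blast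
  define \<theta> where "\<theta> = of_int q * s - of_int h"
  have "\<theta> \<noteq> 0"
  proof
    assume "\<theta> = 0"
    then have "s = of_int h / of_int q" using hq(1) by (simp add: \<theta>_def field_simps)
    then show False using s by simp
  qed
  have \<theta>: "\<bar>\<theta>\<bar> < \<delta>" using hq(3) N(2) by (simp add: \<theta>_def)
  show ?thesis
  proof (rule exI[of _ "nat q * nat \<lfloor>1 / \<bar>\<theta>\<bar>\<rfloor>"], rule allI)
    fix t :: real
    define f where "f = (if \<theta> > 0 then of_int \<lceil>t\<rceil> - t else t - of_int \<lfloor>t\<rfloor>)"
    define K where "K = (if \<theta> > 0 then \<lceil>t\<rceil> else \<lfloor>t\<rfloor>)"
    have f: "0 \<le> f" "f < 1" by (auto simp: f_def) linarith+
    define j where "j = nat \<lfloor>f / \<bar>\<theta>\<bar>\<rfloor>"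
    have jr: "real j = of_int \<lfloor>f / \<bar>\<theta>\<bar>\<rfloor>" using f by (simp add: j_def)
    have "real j \<le> f / \<bar>\<theta>\<bar>" "f / \<bar>\<theta>\<bar> < real j + 1" unfolding jr by linarith+
    then have 1: "real j * \<bar>\<theta>\<bar> \<le> f" "f < real j * \<bar>\<theta>\<bar> + \<bar>\<theta>\<bar>"
      using \<open>\<theta> \<noteq> 0\<close> by (simp_all add: field_simps)
    have "\<bar>t + real j * \<theta> - of_int K\<bar> < \<delta>"
      using 1 \<theta> by (cases "\<theta> > 0") (auto simp: f_def K_def abs_if split: if_splits)
    then have "\<bar>t + s * real (nat q * j) - of_int (K + int j * h)\<bar> < \<delta>"
      using hq(1) by (simp add: \<theta>_def algebra_simps)
    moreover have "nat q * j \<le> nat q * nat \<lfloor>1 / \<bar>\<theta>\<bar>\<rfloor>"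
    proof -
      have "f / \<bar>\<theta>\<bar> \<le> 1 / \<bar>\<theta>\<bar>" using f by (intro divide_right_mono) auto
      then show ?thesis unfolding j_def by (intro mult_left_mono nat_mono floor_mono) auto
    qed
    ultimately show "\<exists>m::nat. m \<le> nat q * nat \<lfloor>1 / \<bar>\<theta>\<bar>\<rfloor> \<and>
        (\<exists>k::int. \<bar>t + s * real m - of_int k\<bar> < \<delta>)" by blast
  qed
qed

lemma close_centers_relatively_dense:
  fixes s \<delta> :: real
  assumes s: "s > 0" "s \<notin> \<rat>" and \<delta>: "\<delta> > 0"
  shows "\<exists>R. \<forall>x. \<exists>k l m n. dist (square_center 1 0 k l) (square_center s z m n) < \<delta> \<and>
    dist x (square_center s z m n) \<le> R"
proof -
  obtain L where L: "\<And>t. \<exists>m::nat. m \<le> L \<and> (\<exists>k::int. \<bar>t + s * real m - of_int k\<bar> < \<delta> / 2)"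
    using irrational_multiples_near_integers[OF s(2), of "\<delta> / 2"] \<delta> by auto
  have coord: "\<exists>m k::int. \<bar>y + s * (of_int m + 1/2) - (of_int k + 1/2)\<bar> < \<delta> / 2 \<and>
      \<bar>x - (y + s * (of_int m + 1/2))\<bar> \<le> s * (real L + 1)" for x y
  proof -
    define m0 where "m0 = \<lfloor>(x - y) / s\<rfloor>"
    have "of_int m0 \<le> (x - y) / s" "(x - y) / s < of_int m0 + 1" unfolding m0_def by linarith+
    then have m0: "s * of_int m0 \<le> x - y" "x - y < s * of_int m0 + s"
      using s(1) by (simp_all add: field_simps)
    obtain m k where mk: "m \<le> L"
      "\<bar>(y + s * (of_int m0 + 1/2) - 1/2) + s * real m - of_int k\<bar> < \<delta> / 2"
      using L by blast
    have "s * real m \<le> s * real L" "0 \<le> s * real m" "0 \<le> s * real L"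
      using mk(1) s(1) by simp_all
    moreover have "x - (y + s * (of_int (m0 + int m) + 1/2)) = (x - y - s * of_int m0) - s * real m - s / 2"
      "s * (real L + 1) = s * real L + s"
      by (simp_all add: algebra_simps)
    ultimately have "\<bar>x - (y + s * (of_int (m0 + int m) + 1/2))\<bar> \<le> s * (real L + 1)"
      using m0 s(1) by linarith
    moreover have "\<bar>y + s * (of_int (m0 + int m) + 1/2) - (of_int k + 1/2)\<bar> < \<delta> / 2"
      using mk(2) by (simp add: algebra_simps)
    ultimately show ?thesis by blast
  qed
  show ?thesis
  proof (rule exI[of _ "2 * (s * (real L + 1))"], rule allI)
    fix x :: complex
    obtain m k :: int where mk: "\<bar>Re z + s * (of_int m + 1/2) - (of_int k + 1/2)\<bar> < \<delta> / 2"
      "\<bar>Re x - (Re z + s * (of_int m + 1/2))\<bar> \<le> s * (real L + 1)" using coord by blast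
    obtain n l :: int where nl: "\<bar>Im z + s * (of_int n + 1/2) - (of_int l + 1/2)\<bar> < \<delta> / 2"
      "\<bar>Im x - (Im z + s * (of_int n + 1/2))\<bar> \<le> s * (real L + 1)" using coord by blast
    have "dist (square_center 1 0 k l) (square_center s z m n) < \<delta>"
      using cmod_le[of "square_center 1 0 k l - square_center s z m n"] mk(1) nl(1)
      by (simp add: dist_norm square_center_def abs_minus_commute)
    moreover have "dist x (square_center s z m n) \<le> 2 * (s * (real L + 1))"
      using cmod_le[of "x - square_center s z m n"] mk(2) nl(2)
      by (simp add: dist_norm square_center_def)
    ultimately show "\<exists>k l m n. dist (square_center 1 0 k l) (square_center s z m n) < \<delta> \<and>
      dist x (square_center s z m n) \<le> 2 * (s * (real L + 1))" by blast
  qed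
qed

lemma fixed_balls_relatively_dense:
  assumes s: "s > 0" "s \<notin> \<rat>" and id: "rot_seq (pi / 2) 0 1 bs = id"
  shows "\<exists>\<delta>>0. \<exists>R. \<forall>x. \<exists>y. ball y \<delta> \<subseteq> fixed_points (turn_seq s z bs) \<inter> cball x R"
proof -
  define N where "N = 2 * real (length bs) + 2"
  define \<delta> where "\<delta> = min 1 s / 2 / N"
  have "N > 0" by (simp add: N_def)
  then have \<delta>: "\<delta> > 0" "N * \<delta> \<le> min 1 s / 2"
    using s(1) by (simp_all add: \<delta>_def)
  obtain R where R: "\<And>x. \<exists>k l m n. dist (square_center 1 0 k l) (square_center s z m n) < \<delta> \<and>
    dist x (square_center s z m n) \<le> R"
    using close_centers_relatively_dense[OF s \<delta>(1), of z] by blast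
  show ?thesis
  proof (rule exI[of _ \<delta>], rule conjI[OF \<delta>(1)], rule exI[of _ "R + 2 * \<delta>"], rule allI)
    fix x :: complex
    obtain k l m n where kl: "dist (square_center 1 0 k l) (square_center s z m n) < \<delta>"
      "dist x (square_center s z m n) \<le> R" using R by blast
    let ?c = "square_center 1 0 k l"
    have "p \<in> fixed_points (turn_seq s z bs) \<inter> cball x (R + 2 * \<delta>)" if p: "p \<in> ball ?c \<delta>" for p
    proof
      have "dist p ?c < \<delta>" using p by (simp add: dist_commute)
      then have "turn_seq s z bs p = Some (rot_seq (- pi / 2) ?c (square_center s z m n) bs p)"
        using turn_seq_near_centers[OF s(1) HOL.refl HOL.refl kl(1) _ \<delta>(2)[unfolded N_def]] by blast
      then show "p \<in> fixed_points (turn_seq s z bs)"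
        by (simp only: fixed_points_def mem_Collect_eq rot_seq_id_transfer[OF id] id_apply)
      show "p \<in> cball x (R + 2 * \<delta>)"
        using p kl dist_triangle[of x p ?c] dist_triangle[of x ?c "square_center s z m n"]
        by (simp add: dist_commute)
    qed
    then show "\<exists>y. ball y \<delta> \<subseteq> fixed_points (turn_seq s z bs) \<inter> cball x (R + 2 * \<delta>)" by blast
  qed
qed


lemma positive_density_if_relatively_dense_balls:
  assumes E: "E \<in> sets lebesgue" and \<delta>: "\<delta> > 0"
    and ex: "\<And>x. \<exists>y. ball y \<delta> \<subseteq> E \<inter> cball x R"
  shows "positive_density E"
proof -
  define M where "M = max R 1"
  have M: "M > 0" by (simp add: M_def)
  have "\<exists>y. ball y \<delta> \<subseteq> E \<inter> cball x M" for x
    using ex[of x] by (auto simp: M_def le_max_iff_disj subset_iff)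
  then obtain y where y: "\<And>x. ball (y x) \<delta> \<subseteq> E \<inter> cball x M" by metis
  define v where "v = measure lebesgue (ball (0::complex) \<delta>)"
  have vol: "measure lebesgue (ball c \<delta>) = v" for c :: complex
    using content_ball_conv_unit_ball[of \<delta> c] content_ball_conv_unit_ball[of \<delta> "0::complex"] \<delta>
    by (simp add: v_def measure_completion)
  have v: "v > 0" using content_ball_pos[of \<delta> "0::complex"] \<delta> by (simp add: v_def measure_completion)
  define X where "X = (\<lambda>(a::nat, b::nat). Complex (3 * M * real a) (3 * M * real b))"
  have far: "dist (X i) (X j) \<ge> 3 * M" if "i \<noteq> j" for i j
  proof -
    obtain a b c d where ij: "i = (a, b)" "j = (c, d)" by fastforce
    have apart: "\<bar>3 * M * real k - 3 * M * real l\<bar> \<ge> 3 * M" if "k \<noteq> l" for k l :: nat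
    proof -
      have "\<bar>real k - real l\<bar> \<ge> 1" using that by (cases "k < l") auto
      then have "3 * M * 1 \<le> 3 * M * \<bar>real k - real l\<bar>"
        using M by (intro mult_left_mono) auto
      also have "\<dots> = \<bar>3 * M * (real k - real l)\<bar>" using M by (simp add: abs_mult)
      finally show ?thesis by (simp add: right_diff_distrib)
    qed
    show ?thesis
      using abs_Re_le_cmod[of "X i - X j"] abs_Im_le_cmod[of "X i - X j"]
        apart[of a c] apart[of b d] that
      by (auto simp: ij X_def dist_norm)
  qed
  define I where "I = (\<lambda>K::nat. {..<K} \<times> {..<K})"
  have lower: "(real K)\<^sup>2 * v \<le> measure lebesgue (E \<inter> ball 0 r)" if K: "8 * M * real K \<le> r" for K r
  proof -
    have "(\<Union>i\<in>I K. ball (y (X i)) \<delta>) \<subseteq> E \<inter> ball 0 r"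
    proof (rule UN_least)
      fix i assume "i \<in> I K"
      then obtain a b where ab: "i = (a, b)" "a < K" "b < K" by (auto simp: I_def)
      have next_le: "3 * M * real k + 3 * M \<le> 3 * M * real K" if "k < K" for k
      proof -
        have "3 * M * (real k + 1) \<le> 3 * M * real K" using that M by (intro mult_left_mono) auto
        then show ?thesis by (simp only: distrib_left mult_1_right)
      qed
      note next_le[OF ab(2)] next_le[OF ab(3)]
      moreover have "norm (X i) \<le> 3 * M * real a + 3 * M * real b"
        using cmod_le[of "X i"] M by (simp add: X_def ab)
      moreover have "0 \<le> M * real K" using M by simp
      ultimately have "norm (X i) + M < r" using K M by linarith
      then have "cball (X i) M \<subseteq> ball 0 r" by (simp add: cball_subset_ball_iff)
      then show "ball (y (X i)) \<delta> \<subseteq> E \<inter> ball 0 r" using y[of "X i"] by blast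
    qed
    moreover have "E \<inter> ball 0 r \<in> lmeasurable"
      using E by (intro bounded_set_imp_lmeasurable) (auto intro: bounded_subset[OF bounded_ball])
    ultimately have "measure lebesgue (\<Union>i\<in>I K. ball (y (X i)) \<delta>) \<le> measure lebesgue (E \<inter> ball 0 r)"
      by (intro measure_mono_fmeasurable) (auto simp: I_def)
    moreover have "measure lebesgue (\<Union>i\<in>I K. ball (y (X i)) \<delta>) = (\<Sum>i\<in>I K. measure lebesgue (ball (y (X i)) \<delta>))"
    proof (rule measure_finite_Union)
      show "disjoint_family_on (\<lambda>i. ball (y (X i)) \<delta>) (I K)"
        unfolding disjoint_family_on_def
      proof (intro ballI impI, rule ccontr)
        fix i j assume "i \<noteq> j" "ball (y (X i)) \<delta> \<inter> ball (y (X j)) \<delta> \<noteq> {}"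
        then obtain q where "q \<in> cball (X i) M" "q \<in> cball (X j) M" using y by blast
        then have "dist (X i) (X j) \<le> 2 * M"
          using dist_triangle2[of "X i" "X j" q] by simp
        then show False using far[OF \<open>i \<noteq> j\<close>] M by linarith
      qed
      show "emeasure lebesgue (ball (y (X i)) \<delta>) \<noteq> \<infinity>" for i
        using emeasure_lborel_ball_finite[of "y (X i)" \<delta>] by simp
    qed (auto simp: I_def)
    ultimately show ?thesis by (simp add: vol I_def power2_eq_square)
  qed
  define C where "C = v / (pi * (16 * M)\<^sup>2)"
  have "C > 0" using v M by (simp add: C_def)
  have "ereal C \<le> ereal (measure lebesgue (E \<inter> ball 0 r) / (pi * r\<^sup>2))" if r: "r \<ge> 16 * M" for r
  proof -
    define K where "K = nat \<lfloor>r / (8 * M)\<rfloor>"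
    have "2 \<le> r / (8 * M)" using r M by (simp add: field_simps)
    then have "real K \<le> r / (8 * M)" "r / (8 * M) < real K + 1" by (simp_all add: K_def)
    then have K: "8 * M * real K \<le> r" "r / (16 * M) \<le> real K"
      using \<open>2 \<le> r / (8 * M)\<close> M by (simp_all add: field_simps)
    have "C * (pi * r\<^sup>2) = (r / (16 * M))\<^sup>2 * v"
      using M by (simp add: C_def power_divide)
    also have "\<dots> \<le> (real K)\<^sup>2 * v"
      using K(2) r M v by (intro mult_right_mono power_mono) auto
    also have "\<dots> \<le> measure lebesgue (E \<inter> ball 0 r)" by (rule lower[OF K(1)])
    finally show ?thesis using r M by (simp add: le_divide_eq)
  qed
  then have "ereal C \<le> Liminf at_top (\<lambda>r::real. ereal (measure lebesgue (E \<inter> ball 0 r) / (pi * r\<^sup>2)))"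
    by (intro Liminf_bounded eventually_at_top_linorderI[of "16 * M"])
  moreover have "0 < ereal C" using \<open>C > 0\<close> by simp
  ultimately show ?thesis unfolding positive_density_def by (rule less_le_trans[rotated])
qed


section \<open>Domain components and islands\<close>

lemma grid_square_index:
  assumes "s > 0" "p \<in> interior (grid_square s z m n)"
  shows "m = \<lfloor>(Re p - Re z) / s\<rfloor>" "n = \<lfloor>(Im p - Im z) / s\<rfloor>"
  using assms
  by (auto simp: grid_square_def interior_cbox in_box_complex_iff field_simps
      intro!: floor_unique[symmetric])

lemma dom_turn: "dom (turn s z) = (\<Union>m n. interior (grid_square s z m n))"
proof -
  have "p \<in> dom (turn s z) \<longleftrightarrow> (\<exists>m n. p \<in> interior (grid_square s z m n))" for p
    unfolding turn_def dom_def Let_def by simp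
  then show ?thesis by blast
qed

lemma connected_subset_grid_square:
  assumes s: "s > 0" and S: "connected S" "S \<subseteq> dom (turn s z)"
    and p: "p \<in> S" "p \<in> interior (grid_square s z m n)"
  shows "S \<subseteq> interior (grid_square s z m n)"
proof -
  define A where "A = interior (grid_square s z m n)"
  define B where "B = (\<Union>i. \<Union>j\<in>{j. (i, j) \<noteq> (m, n)}. interior (grid_square s z i j))"
  have B: "q \<in> B \<longleftrightarrow> (\<exists>i j. (i, j) \<noteq> (m, n) \<and> q \<in> interior (grid_square s z i j))" for q
    unfolding B_def by blast
  have "q \<notin> B" if q: "q \<in> A" for q
  proof
    assume "q \<in> B"
    then obtain i j where ij: "(i, j) \<noteq> (m, n)" "q \<in> interior (grid_square s z i j)"
      unfolding B by blast
    then show False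
      using grid_square_index[OF s ij(2)] grid_square_index[OF s q[unfolded A_def]] by simp
  qed
  then have "A \<inter> B \<inter> S = {}" by blast
  moreover have SAB: "S \<subseteq> A \<union> B"
  proof
    fix q assume "q \<in> S"
    then obtain i j where "q \<in> interior (grid_square s z i j)" using S(2) dom_turn by blast
    then show "q \<in> A \<union> B" using B by (cases "(i, j) = (m, n)") (auto simp: A_def)
  qed
  moreover have "open A" "open B" unfolding A_def B_def by (intro open_UN ballI open_interior)+
  ultimately have "A \<inter> S = {} \<or> B \<inter> S = {}" using connectedD[OF S(1), of A B] by simp
  moreover have "A \<inter> S \<noteq> {}" using p by (auto simp: A_def)
  ultimately show ?thesis using SAB by (auto simp: A_def)
qed

lemma quarter_turn_vimage_box:
  "\<exists>c d. {q. (- \<i>) ^ n * q + v \<in> box a b} = box c (d :: complex)"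
proof (induction n)
  case 0
  have "{q. (- \<i>) ^ 0 * q + v \<in> box a b} = box (a - v) (b - v)"
    by (auto simp: in_box_complex_iff)
  then show ?case by blast
next
  case (Suc n)
  then obtain c d where "{q. (- \<i>) ^ n * q + v \<in> box a b} = box c d" by blast
  then have cd: "(- \<i>) ^ n * q + v \<in> box a b \<longleftrightarrow> q \<in> box c d" for q by blast
  have "(- \<i>) ^ Suc n * q = (- \<i>) ^ n * (- \<i> * q)" for q by simp
  then have "{q. (- \<i>) ^ Suc n * q + v \<in> box a b} = {q. - \<i> * q \<in> box c d}"
    by (simp only: cd)
  also have "\<dots> = box (Complex (- Im d) (Re c)) (Complex (- Im c) (Re d))"
    by (auto simp: in_box_complex_iff)
  finally show ?case by blast
qed

lemma turn_seq_component:
  assumes s: "s > 0" and p: "p \<in> dom (turn_seq s z bs)"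
  shows "\<exists>v D. p \<in> D \<and> (\<forall>q\<in>D. turn_seq s z bs q = Some ((- \<i>) ^ length bs * q + v)) \<and>
    (\<forall>S. connected S \<and> p \<in> S \<and> S \<subseteq> dom (turn_seq s z bs) \<longrightarrow> S \<subseteq> D) \<and>
    (if bs = [] then D = UNIV else \<exists>a b. D = box a b)"
  using p
proof (induction bs)
  case Nil
  show ?case by (rule exI[of _ 0], rule exI[of _ UNIV]) simp
next
  case (Cons e bs)
  define f where "f = turn_seq s z bs"
  define t x where "t = (if e then s else 1)" and "x = (if e then z else 0)"
  have t: "t > 0" using s by (simp add: t_def)
  have F: "turn_seq s z (e # bs) = turn t x \<circ>\<^sub>m f" by (simp add: f_def t_def x_def)
  have dom: "dom (turn t x \<circ>\<^sub>m f) \<subseteq> dom f" by (auto simp: map_comp_Some_iff)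
  define u where "u = (- \<i>) ^ length bs"
  have "p \<in> dom (turn_seq s z bs)" using Cons.prems dom unfolding F f_def by blast
  from Cons.IH[OF this, folded f_def u_def] obtain v D where D: "p \<in> D"
    "\<forall>q\<in>D. f q = Some (u * q + v)"
    "\<forall>S. connected S \<and> p \<in> S \<and> S \<subseteq> dom f \<longrightarrow> S \<subseteq> D"
    "if bs = [] then D = UNIV else \<exists>a b. D = box a b"
    by (elim exE conjE) (rule that)
  have "u * p + v \<in> dom (turn t x)"
    using Cons.prems D(1,2) unfolding F by (auto simp: map_comp_Some_iff)
  then obtain m n where mn: "u * p + v \<in> interior (grid_square t x m n)"
    unfolding dom_turn by blast
  let ?Q = "interior (grid_square t x m n)" and ?c = "square_center t x m n"
  define D' where "D' = D \<inter> {q. u * q + v \<in> ?Q}"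
  have cis: "cis (- pi / 2) = - \<i>" by (simp add: complex_eq_iff)
  have "turn_seq s z (e # bs) q = Some ((- \<i>) ^ length (e # bs) * q + (?c - \<i> * (v - ?c)))"
    if "q \<in> D'" for q
  proof -
    have "f q = Some (u * q + v)" "u * q + v \<in> ?Q" using that D(2) by (auto simp: D'_def)
    then show ?thesis unfolding F using turn_eq[OF t, of "u * q + v" x m n]
      by (simp only: map_comp_simps rot_def cis) (simp add: u_def algebra_simps)
  qed
  moreover have "S \<subseteq> D'" if S: "connected S" "p \<in> S" "S \<subseteq> dom (turn_seq s z (e # bs))" for S
  proof -
    have SD: "S \<subseteq> D" using D(3) S dom F by (metis subset_trans)
    have "(\<lambda>q. u * q + v) ` S \<subseteq> ?Q"
    proof (rule connected_subset_grid_square[OF t])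
      show "connected ((\<lambda>q. u * q + v) ` S)"
        by (intro connected_continuous_image continuous_intros S(1))
      show "(\<lambda>q. u * q + v) ` S \<subseteq> dom (turn t x)"
      proof
        fix y assume "y \<in> (\<lambda>q. u * q + v) ` S"
        then obtain q where q: "q \<in> S" "y = u * q + v" by blast
        then have "q \<in> dom (turn t x \<circ>\<^sub>m f)" "f q = Some y" using S(3) SD D(2) F by auto
        then show "y \<in> dom (turn t x)" by (auto simp: map_comp_Some_iff)
      qed
      show "u * p + v \<in> (\<lambda>q. u * q + v) ` S" using S(2) by blast
    qed (rule mn)
    then show ?thesis using SD by (auto simp: D'_def)
  qed
  moreover have "p \<in> D'" using D(1) mn by (simp add: D'_def)
  moreover have "\<exists>a b. D' = box a b"
  proof -
    obtain a b where ab: "{q. u * q + v \<in> ?Q} = box a b"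
      using quarter_turn_vimage_box unfolding u_def grid_square_def interior_cbox by blast
    show ?thesis
    proof (cases "bs = []")
      case True
      then show ?thesis using D(4) ab unfolding D'_def by auto
    next
      case False
      then obtain c d where "D = box c d" using D(4) by auto
      then have "D' = box (Complex (max (Re c) (Re a)) (max (Im c) (Im a)))
          (Complex (min (Re d) (Re b)) (min (Im d) (Im b)))"
        unfolding D'_def ab by (auto simp: in_box_complex_iff)
      then show ?thesis by blast
    qed
  qed
  ultimately show ?case by (intro exI[of _ "?c - \<i> * (v - ?c)"] exI[of _ D']) auto
qed

lemma fixed_point_component:
  assumes s: "s > 0" and bs: "4 dvd length bs" and p: "p \<in> fixed_points (turn_seq s z bs)"
  shows "\<exists>D. p \<in> D \<and> D \<subseteq> fixed_points (turn_seq s z bs) \<and>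
    (\<forall>S. connected S \<and> p \<in> S \<and> S \<subseteq> dom (turn_seq s z bs) \<longrightarrow> S \<subseteq> D) \<and>
    (if bs = [] then D = UNIV else \<exists>a b. D = box a b)"
proof -
  have "p \<in> dom (turn_seq s z bs)" using p by (auto simp: fixed_points_def)
  from turn_seq_component[OF s this] obtain v D where D: "p \<in> D"
    "\<forall>q\<in>D. turn_seq s z bs q = Some ((- \<i>) ^ length bs * q + v)"
    "\<forall>S. connected S \<and> p \<in> S \<and> S \<subseteq> dom (turn_seq s z bs) \<longrightarrow> S \<subseteq> D"
    "if bs = [] then D = UNIV else \<exists>a b. D = box a b"
    by (elim exE conjE) (rule that)
  obtain k where "length bs = 4 * k" using bs by blast
  moreover have "(- \<i>) ^ 4 = 1" by (simp add: power4_eq_xxxx)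
  ultimately have u: "(- \<i>) ^ length bs = 1" by (simp add: power_mult)
  then have "v = 0" using D(1,2) p by (simp add: fixed_points_def)
  then have "D \<subseteq> fixed_points (turn_seq s z bs)" using D(2) u by (auto simp: fixed_points_def)
  then show ?thesis using D(1,3,4) by (intro exI[of _ D] conjI)
qed

lemma open_fixed_points:
  assumes "s > 0" "4 dvd length bs"
  shows "open (fixed_points (turn_seq s z bs))"
proof (subst open_subopen, rule ballI)
  fix p assume "p \<in> fixed_points (turn_seq s z bs)"
  from fixed_point_component[OF assms this]
  show "\<exists>T. open T \<and> p \<in> T \<and> T \<subseteq> fixed_points (turn_seq s z bs)"
    by (cases "bs = []") (auto intro: open_box)
qed

lemma pfun_pow_dom:
  assumes "n > 0" "pfun_pow f n q = Some y"
  shows "q \<in> dom f"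
  using assms
proof (induction n arbitrary: y)
  case (Suc n)
  then show ?case
    by (cases "n = 0") (auto simp: pfun_pow_Suc map_comp_Some_iff, simp add: pfun_pow_def)
qed simp

lemma fixed_point_periodic:
  assumes "p \<in> fixed_points f"
  shows "periodic_point f p" "period f p = 1"
proof -
  have "pfun_pow f 1 p = Some p" using assms by (simp add: pfun_pow_def fixed_points_def)
  then show "periodic_point f p" "period f p = 1"
    unfolding periodic_point_def period_def by (auto intro!: Least_equality exI[of _ 1])
qed

lemma fixed_point_island:
  assumes s: "s > 0" and bs: "4 dvd length bs" "bs \<noteq> []"
    and p: "p \<in> fixed_points (turn_seq s z bs)"
  shows "\<exists>P. p \<in> P \<and> bounded P \<and> P \<in> islands_of_period (turn_seq s z bs) 1"
proof -
  let ?f = "turn_seq s z bs"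
  obtain a b where D: "p \<in> box a b" "box a b \<subseteq> fixed_points ?f"
    and max: "\<And>S. connected S \<Longrightarrow> p \<in> S \<Longrightarrow> S \<subseteq> dom ?f \<Longrightarrow> S \<subseteq> box a b"
    using fixed_point_component[OF s bs(1) p] bs(2) by auto
  have "open_convex_polygon (box a b)"
    unfolding open_convex_polygon_def using D(1) polytope_interval[of a b] interior_cbox[of a b]
    by blast
  moreover have "\<forall>q\<in>box a b. periodic_point ?f q" using D(2) fixed_point_periodic by blast
  moreover have "Q \<subseteq> box a b"
    if Q: "open_convex_polygon Q" "p \<in> Q" "\<forall>q\<in>Q. periodic_point ?f q" for Q
  proof (rule max)
    show "connected Q"
      using Q(1) convex_connected convex_interior polytope_imp_convex
      unfolding open_convex_polygon_def by blast
    show "Q \<subseteq> dom ?f" using Q(3) pfun_pow_dom unfolding periodic_point_def by blast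
  qed (rule Q(2))
  ultimately have "is_periodic_island ?f p (box a b)"
    using D(1) by (simp add: is_periodic_island_def)
  then have "box a b \<in> islands_of_period ?f 1"
    unfolding islands_of_period_def using fixed_point_periodic[OF p] by blast
  then show ?thesis using D(1) bounded_box by blast
qed

theorem theorem1p2:
  fixes H :: "(int + int) list set \<Rightarrow> complex \<Rightarrow> complex"
    and g :: "(int + int) list set" and w :: "(int + int) list"
    and s :: real and z :: complex
  assumes "H \<in> hom GG Isom"
    and "H gen1 = rot (pi / 2) 0"
    and "H gen2 = rot (pi / 2) 1"
    and "g \<in> GG0"
    and "H g = \<one>\<^bsub>Isom\<^esub>"
    and "w \<in> g"
    and "s > 0" and "s \<notin> \<rat>"
  shows "positive_density (fixed_points (word_map s z w))
    \<and> (total_exponent w > 0 \<longrightarrow> infinite (islands_of_period (word_map s z w) 1))"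
proof -
  define bs where "bs = word_turns w"
  let ?f = "turn_seq s z bs"
  have gc: "g \<in> fp_words Z4 Z4 // fp_rel Z4 Z4"
    using assms(4) by (simp only: GG0_def GG_def fp_carrier mem_Collect_eq)
  have dvd: "4 dvd total_exponent w" using assms(4,6) unfolding GG0_def by blast
  note equiv = equiv_fp_rel[OF group_integer_mod_group group_integer_mod_group, of 4 4]
  have w: "w \<in> fp_words Z4 Z4"
    using in_quotient_imp_subset[OF equiv gc] assms(6) by blast
  obtain v where v: "g = fp_rel Z4 Z4 `` {v}" using gc by (rule quotientE)
  then have "(v, w) \<in> fp_rel Z4 Z4" using assms(6) by blast
  then have g: "g = fp_rel Z4 Z4 `` {w}" unfolding v by (rule equiv_class_eq[OF equiv])
  have id: "rot_seq (pi / 2) 0 1 bs = id"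
    using hom_GG_word[OF assms(1-3) w] assms(5) by (simp add: g bs_def Isom_def)
  have len: "int (length bs) = total_exponent w" using length_word_turns[OF w] by (simp add: bs_def)
  then have bs: "4 dvd length bs" using dvd by presburger
  obtain \<delta> R where \<delta>: "\<delta> > 0" and R: "\<And>x. \<exists>y. ball y \<delta> \<subseteq> fixed_points ?f \<inter> cball x R"
    using fixed_balls_relatively_dense[OF assms(7,8) id] by blast
  have "positive_density (fixed_points ?f)"
    by (rule positive_density_if_relatively_dense_balls[OF _ \<delta> R])
      (use open_fixed_points[OF assms(7) bs] in auto)
  moreover have "infinite (islands_of_period ?f 1)" if "total_exponent w > 0"
  proof
    assume fin: "finite (islands_of_period ?f 1)"
    have "bs \<noteq> []" using that len by auto
    note island = fixed_point_island[OF assms(7) bs this]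
    let ?U = "\<Union>{P \<in> islands_of_period ?f 1. bounded P}"
    have "bounded ?U" using fin by (intro bounded_Union) auto
    moreover have "fixed_points ?f \<subseteq> ?U" using island by blast
    ultimately have "bounded (fixed_points ?f)" by (rule bounded_subset)
    then obtain B where B: "\<And>p. p \<in> fixed_points ?f \<Longrightarrow> norm p \<le> B"
      unfolding bounded_iff by blast
    define x :: complex where "x = of_real (\<bar>B\<bar> + \<bar>R\<bar> + 1)"
    have "norm x = \<bar>B\<bar> + \<bar>R\<bar> + 1" unfolding x_def norm_of_real by simp
    obtain y where y: "ball y \<delta> \<subseteq> fixed_points ?f \<inter> cball x R" using R by blast
    have "y \<in> ball y \<delta>" using \<delta> by simp
    with y have "y \<in> fixed_points ?f" "y \<in> cball x R" by blast+
    then have "norm y \<le> B" "norm (x - y) \<le> R" using B by (simp_all add: dist_norm)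
    then show False
      using norm_triangle_ineq2[of x y] \<open>norm x = \<bar>B\<bar> + \<bar>R\<bar> + 1\<close> by linarith
  qed
  ultimately show ?thesis by (simp add: word_map_eq_turn_seq bs_def)
qed

end
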